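(* There is an absolute constant $C>0$ such that the following holds. Let $D\ge 1$, let $P\subset\mathbb{R}^D$ be a set of $N\ge 2$ points, let $c>0$ and $\epsilon\in[N^{-(c+2)/2},1]$, and let $$k=\left\lceil\frac{C\ln^2(N^{c+2})}{\epsilon^2}\right\rceil.$$ Let $F:\mathbb{R}^D\to\mathbb{R}^k$ be the random linear map whose matrix entries are i.i.d. standard Cauchy random variables. Then, with probability at least $1-N^{-c}$, the bound $$(1-\epsilon)\,\frac{1-\epsilon^2/\sqrt{2}}{1+3\epsilon^2}\;\mu(\|x-y\|_1)\leq \rho\big(F(x),F(y)\big)$$ holds simultaneously for all $x,y\in P$ with $\|x-y\|_1<2$.
   Context: $\mathrm{Cauchy}(1)$ is the standard Cauchy distribution on $\mathbb{R}$, with density $\frac{1}{\pi(1+x^2)}$. For $\lambda\ge 0$ define $\xi(\lambda):=\ln(1+\sqrt{\lambda})+\frac12\ln(1+\lambda)$ and $\mu(\lambda):=\mathbb{E}\,\xi(\lambda|X|)$ with $X\sim\mathrm{Cauchy}(1)$. For $u,v\in\mathbb{R}^k$ define the metric $\rho(u,v):=\frac1k\sum_{i=1}^k\xi(|u_i-v_i|)$. $\|\cdot\|_1$ is the 1-norm on $\mathbb{R}^D$. *)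

theory Defs
  imports "HOL-Probability.Probability" "Jordan_Normal_Form.Matrix"
begin

unbundle no vec_syntax

definition std_cauchy :: "real measure" where
  "std_cauchy = density lborel (\<lambda>x. ennreal (1 / (pi * (1 + x\<^sup>2))))"

lemma prob_space_std_cauchy: "prob_space std_cauchy"
proof
  have integrable: "integrable lborel (\<lambda>x::real. inverse (1 + x\<^sup>2))"
    using integrable_inverse_1_plus_square by (simp add: set_integrable_def einterval_def)
  have integral: "(LINT x|lborel. inverse (1 + x\<^sup>2)) = pi"
    using LBINT_inverse_1_plus_square
    by (simp add: interval_lebesgue_integral_def set_lebesgue_integral_def einterval_def)
  have "(\<integral>\<^sup>+x. ennreal (1 / (pi * (1 + x\<^sup>2))) \<partial>lborel)
      = (\<integral>\<^sup>+x. ennreal (1 / pi * inverse (1 + x\<^sup>2)) \<partial>lborel)"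
    by (simp add: divide_inverse)
  also have "\<dots> = ennreal (LINT x|lborel. 1 / pi * inverse (1 + x\<^sup>2))"
    by (rule nn_integral_eq_integral) (use integrable in auto)
  also have "\<dots> = 1"
    by (simp only: integral_mult_right_zero integral) simp
  finally show "emeasure std_cauchy (space std_cauchy) = 1"
    by (simp add: std_cauchy_def emeasure_density)
qed

text \<open>The law of the entries \<open>A (i, j)\<close>, \<open>i < k\<close>, \<open>j < D\<close>, of a random matrix with
  i.i.d. standard Cauchy entries. An outcome \<open>A\<close> of this product space gives the matrix
  \<open>mat k D A\<close>.\<close>

definition cauchy_entries :: "nat \<Rightarrow> nat \<Rightarrow> (nat \<times> nat \<Rightarrow> real) measure" where
  "cauchy_entries k D = (\<Pi>\<^sub>M ij \<in> {..<k} \<times> {..<D}. std_cauchy)"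

definition \<xi> :: "real \<Rightarrow> real" where
  "\<xi> l = ln (1 + sqrt l) + 1 / 2 * ln (1 + l)"

definition \<mu> :: "real \<Rightarrow> real" where
  "\<mu> l = prob_space.expectation std_cauchy (\<lambda>x. \<xi> (l * \<bar>x\<bar>))"

definition \<rho> :: "nat \<Rightarrow> real vec \<Rightarrow> real vec \<Rightarrow> real" where
  "\<rho> k u v = 1 / real k * (\<Sum>i<k. \<xi> \<bar>u $ i - v $ i\<bar>)"

definition norm1 :: "real vec \<Rightarrow> real" where
  "norm1 v = (\<Sum>i<dim_vec v. \<bar>v $ i\<bar>)"

end

theory Submission
  imports Defs "HOL-Real_Asymp.Real_Asymp"
begin

text \<open>The coordinates of \<open>F x - F y\<close> are i.i.d. with the law of \<open>l X\<close>, where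
  \<open>l = norm1 (x - y)\<close> and \<open>X\<close> is standard Cauchy, by 1-stability of the Cauchy
  distribution. A second-moment Chernoff bound for the lower tail of the mean of the nonnegative
  variables \<open>\<xi> (l \<bar>X\<bar>)\<close> would need a bound on \<open>E (\<xi> (l \<bar>X\<bar>))\<^sup>2\<close> by a multiple of \<open>(\<mu> l)\<^sup>2\<close>,
  which fails as \<open>l\<close> tends to 0. The remedy is to use the moment of order
  \<open>p = 2 - 1 / (2 L)\<close> with \<open>L = (c + 2) ln N\<close> instead, via \<open>exp (- u) \<le> 1 - u + u powr p\<close>:
  it costs a factor of order \<open>L\<close>, and since \<open>\<epsilon> \<ge> exp (- L / 2)\<close> the powers \<open>\<epsilon> powr (1 / L)\<close> that
  appear are harmless constants. This even gives the bound with \<open>1 - \<epsilon>\<close> in place of the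
  smaller factor of the theorem. A union bound over the \<open>N\<^sup>2\<close> pairs concludes.\<close>

section \<open>Cauchy laws: scaling, convolution and 1-stability\<close>

text \<open>The parameter \<open>s > 0\<close> is the scale. At \<open>s = 0\<close> the function
  vanishes identically, whereas the scaled law degenerates to a point mass at 0, so zero scales are
  treated separately below.\<close>

definition cauchy_density :: "real \<Rightarrow> real \<Rightarrow> real" where
  "cauchy_density s x = s / (pi * (s\<^sup>2 + x\<^sup>2))"

lemma sets_std_cauchy [measurable_cong, simp]: "sets std_cauchy = sets borel"
  and space_std_cauchy [simp]: "space std_cauchy = UNIV"
  by (simp_all add: std_cauchy_def)

lemma cauchy_density_nonneg: "0 \<le> s \<Longrightarrow> 0 \<le> cauchy_density s x"
  by (simp add: cauchy_density_def)

lemma borel_measurable_cauchy_density [measurable]: "cauchy_density s \<in> borel_measurable borel"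
  unfolding cauchy_density_def by measurable

lemma std_cauchy_eq_density: "std_cauchy = density lborel (cauchy_density 1)"
  by (simp add: std_cauchy_def cauchy_density_def)

lemma distr_std_cauchy_scale:
  assumes "v \<noteq> 0"
  shows "distr std_cauchy borel (\<lambda>x. v * x) = density lborel (cauchy_density \<bar>v\<bar>)"
proof -
  interpret prob_space std_cauchy by (rule prob_space_std_cauchy)
  have "distributed std_cauchy lborel (\<lambda>x. x) (cauchy_density 1)"
    unfolding distributed_def
    by (auto simp: std_cauchy_eq_density distr_id2 cauchy_density_nonneg)
  from distributed_affine[OF this, of v 0] assms
  have "distributed std_cauchy lborel (\<lambda>x. v * x) (\<lambda>x. cauchy_density 1 (x / v) / \<bar>v\<bar>)"
    by (simp add: cauchy_density_nonneg divide_ennreal)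
  moreover have "cauchy_density 1 (x / v) / \<bar>v\<bar> = cauchy_density \<bar>v\<bar> x" for x
  proof -
    have "1\<^sup>2 + (x / v)\<^sup>2 = (v\<^sup>2 + x\<^sup>2) / v\<^sup>2"
      using assms by (simp add: power_divide add_divide_distrib)
    moreover have "v\<^sup>2 / \<bar>v\<bar> = \<bar>v\<bar>"
      using assms by (simp add: power2_eq_square abs_if)
    ultimately show ?thesis
      unfolding cauchy_density_def by (metis divide_divide_eq_left' divide_divide_eq_right mult.commute mult_1 power2_abs times_divide_eq_left)
  qed
  ultimately show ?thesis
    by (simp add: distributed_def cong: distr_cong)
qed

text \<open>The numerators solve the partial fraction ansatz, and \<open>d\<close> is the resultant
  of the two quadratics in \<open>x\<close>. The condition \<open>z \<noteq> 0\<close> keeps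
  \<open>d\<close> positive when \<open>a = b\<close>. The terms linear in \<open>x\<close>
  integrate to logarithms, the constant ones to arctangents.\<close>

lemma partial_fraction_sum_squares:
  fixes a b x z :: real
  assumes "a > 0" "b > 0" "z \<noteq> 0"
  defines "d \<equiv> ((a + b)\<^sup>2 + z\<^sup>2) * ((a - b)\<^sup>2 + z\<^sup>2)"
  shows "1 / ((a\<^sup>2 + x\<^sup>2) * (b\<^sup>2 + (z - x)\<^sup>2)) =
    ((2 * z * x + (z\<^sup>2 + b\<^sup>2 - a\<^sup>2)) / (a\<^sup>2 + x\<^sup>2)
     + ((z\<^sup>2 + a\<^sup>2 - b\<^sup>2) - 2 * z * (x - z)) / (b\<^sup>2 + (z - x)\<^sup>2)) / d"
proof -
  have pos: "a\<^sup>2 + x\<^sup>2 > 0" "b\<^sup>2 + (z - x)\<^sup>2 > 0" "d > 0"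
    using assms by (simp_all add: d_def add_pos_nonneg add_nonneg_pos)
  have "(2 * z * x + (z\<^sup>2 + b\<^sup>2 - a\<^sup>2)) * (b\<^sup>2 + (z - x)\<^sup>2)
     + ((z\<^sup>2 + a\<^sup>2 - b\<^sup>2) - 2 * z * (x - z)) * (a\<^sup>2 + x\<^sup>2) = d"
    unfolding d_def by (simp add: power2_eq_square algebra_simps)
  moreover have "1 / (p * q) = (A / p + B / q) / e"
    if "A * q + B * p = e" "p > 0" "q > 0" "e > 0" for A B p q e :: real
    using that by (simp add: field_simps)
  ultimately show ?thesis
    using pos by blast
qed

text \<open>The integrand has an elementary antiderivative by partial fractions, so only its limits
  at both ends are needed. The excluded point \<open>z = 0\<close> is a null set.\<close>

lemma convolution_cauchy_density:
  fixes a b z :: real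
  assumes "a > 0" "b > 0" "z \<noteq> 0"
  shows "(\<integral>\<^sup>+x. ennreal (cauchy_density b (z - x)) * ennreal (cauchy_density a x) \<partial>lborel)
    = ennreal (cauchy_density (a + b) z)"
proof -
  define d where "d = ((a + b)\<^sup>2 + z\<^sup>2) * ((a - b)\<^sup>2 + z\<^sup>2)"
  define f where "f x = cauchy_density b (z - x) * cauchy_density a x" for x
  \<comment> \<open>Termwise integral of the partial fractions. The two logarithms are kept as one
    quotient, which tends to 0 at both ends; only the arctangents survive, and they give the limits
    \<open>T\<close> and \<open>- T\<close>.\<close>
  define G where "G x = a * b / (pi\<^sup>2 * d) *
    (z * ln ((a\<^sup>2 + x\<^sup>2) / (b\<^sup>2 + (z - x)\<^sup>2)) + (z\<^sup>2 + b\<^sup>2 - a\<^sup>2) / a * arctan (x / a)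
     + (z\<^sup>2 + a\<^sup>2 - b\<^sup>2) / b * arctan ((x - z) / b))" for x
  define T where "T = a * b / (pi\<^sup>2 * d) *
    ((z\<^sup>2 + b\<^sup>2 - a\<^sup>2) / a * (pi / 2) + (z\<^sup>2 + a\<^sup>2 - b\<^sup>2) / b * (pi / 2))"
  have d: "d > 0"
    using assms by (auto simp: d_def intro!: add_nonneg_pos mult_pos_pos)
  have pos: "a\<^sup>2 + x\<^sup>2 > 0" "b\<^sup>2 + (z - x)\<^sup>2 > 0" for x
    using assms by (auto intro!: add_pos_nonneg)
  have deriv: "(G has_real_derivative f x) (at x)" for x
  proof -
    have ln_eq: "ln ((a\<^sup>2 + x\<^sup>2) / (b\<^sup>2 + (z - x)\<^sup>2)) = ln (a\<^sup>2 + x\<^sup>2) - ln (b\<^sup>2 + (z - x)\<^sup>2)" for x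
      using pos[of x] by (intro ln_divide_pos)
    have at: "((\<lambda>x. arctan ((x - w) / s)) has_real_derivative s / (s\<^sup>2 + (x - w)\<^sup>2)) (at x)"
      if "s > 0" for s w
    proof -
      have "((\<lambda>x. arctan ((x - w) / s)) has_real_derivative
          inverse (1 + ((x - w) / s)\<^sup>2) * (1 / s)) (at x)"
        using that by (auto intro!: derivative_eq_intros)
      moreover have "inverse (1 + ((x - w) / s)\<^sup>2) * (1 / s) = s / (s\<^sup>2 + (x - w)\<^sup>2)"
      proof -
        have "s\<^sup>2 + (x - w)\<^sup>2 > 0" using that by (auto intro!: add_pos_nonneg)
        moreover have "1 + ((x - w) / s)\<^sup>2 = (s\<^sup>2 + (x - w)\<^sup>2) / s\<^sup>2"
          using that by (simp add: power_divide add_divide_distrib)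
        ultimately show ?thesis using that by (simp add: field_simps power2_eq_square)
      qed
      ultimately show ?thesis by simp
    qed
    have ln1: "((\<lambda>x. ln (a\<^sup>2 + x\<^sup>2)) has_real_derivative 2 * x / (a\<^sup>2 + x\<^sup>2)) (at x)"
      using pos(1)[of x] by (auto intro!: derivative_eq_intros)
    have ln2: "((\<lambda>x. ln (b\<^sup>2 + (z - x)\<^sup>2)) has_real_derivative
        2 * (x - z) / (b\<^sup>2 + (z - x)\<^sup>2)) (at x)"
      using pos(2)[of x] by (auto intro!: derivative_eq_intros)
    have "(G has_real_derivative a * b / (pi\<^sup>2 * d) *
      (z * (2 * x / (a\<^sup>2 + x\<^sup>2) - 2 * (x - z) / (b\<^sup>2 + (z - x)\<^sup>2))
       + (z\<^sup>2 + b\<^sup>2 - a\<^sup>2) / a * (a / (a\<^sup>2 + x\<^sup>2))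
       + (z\<^sup>2 + a\<^sup>2 - b\<^sup>2) / b * (b / (b\<^sup>2 + (z - x)\<^sup>2)))) (at x)"
      unfolding G_def ln_eq
      using at[of a 0] at[of b z] assms
      by (intro DERIV_cmult DERIV_add DERIV_diff ln1 ln2) (simp_all add: power2_commute[of x z])
    also have "a * b / (pi\<^sup>2 * d) *
      (z * (2 * x / (a\<^sup>2 + x\<^sup>2) - 2 * (x - z) / (b\<^sup>2 + (z - x)\<^sup>2))
       + (z\<^sup>2 + b\<^sup>2 - a\<^sup>2) / a * (a / (a\<^sup>2 + x\<^sup>2))
       + (z\<^sup>2 + a\<^sup>2 - b\<^sup>2) / b * (b / (b\<^sup>2 + (z - x)\<^sup>2)))
      = a * b / pi\<^sup>2 * (((2 * z * x + (z\<^sup>2 + b\<^sup>2 - a\<^sup>2)) / (a\<^sup>2 + x\<^sup>2)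
     + ((z\<^sup>2 + a\<^sup>2 - b\<^sup>2) - 2 * z * (x - z)) / (b\<^sup>2 + (z - x)\<^sup>2)) / d)"
    proof -
      \<comment> \<open>Quadratic denominators and constant numerators are abstracted to variables,
        so that \<open>a\<close> and \<open>b\<close> cancel without the squares being
        expanded.\<close>
      have "a * b / (pi\<^sup>2 * d) * (z * (2 * x / p - 2 * (x - z) / q) + m / a * (a / p) + n / b * (b / q))
        = a * b / pi\<^sup>2 * (((2 * z * x + m) / p + (n - 2 * z * (x - z)) / q) / d)" for p q m n
        using assms by (simp add: add_divide_distrib diff_divide_distrib algebra_simps)
      then show ?thesis .
    qed
    also have "\<dots> = f x"
      unfolding d_def partial_fraction_sum_squares[OF assms, symmetric]
      by (simp add: f_def cauchy_density_def power2_eq_square mult_ac)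
    finally show ?thesis .
  qed
  have top: "(G \<longlongrightarrow> T) at_top"
  proof -
    have "((\<lambda>x. ln ((a\<^sup>2 + x\<^sup>2) / (b\<^sup>2 + (z - x)\<^sup>2))) \<longlongrightarrow> 0) at_top" by real_asymp
    moreover have "((\<lambda>x. arctan (x / a)) \<longlongrightarrow> pi / 2) at_top" using assms by real_asymp
    moreover have "((\<lambda>x. arctan ((x - z) / b)) \<longlongrightarrow> pi / 2) at_top" using assms by real_asymp
    ultimately have "(G \<longlongrightarrow> a * b / (pi\<^sup>2 * d) * (z * 0 +
      (z\<^sup>2 + b\<^sup>2 - a\<^sup>2) / a * (pi / 2) + (z\<^sup>2 + a\<^sup>2 - b\<^sup>2) / b * (pi / 2))) at_top"
      unfolding G_def by (intro tendsto_intros)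
    then show ?thesis by (simp add: T_def)
  qed
  have bot: "(G \<longlongrightarrow> - T) at_bot"
  proof -
    have "((\<lambda>x. ln ((a\<^sup>2 + x\<^sup>2) / (b\<^sup>2 + (z - x)\<^sup>2))) \<longlongrightarrow> 0) at_bot" by real_asymp
    moreover have "((\<lambda>x. arctan (x / a)) \<longlongrightarrow> - (pi / 2)) at_bot" using assms by real_asymp
    moreover have "((\<lambda>x. arctan ((x - z) / b)) \<longlongrightarrow> - (pi / 2)) at_bot" using assms by real_asymp
    ultimately have "(G \<longlongrightarrow> a * b / (pi\<^sup>2 * d) * (z * 0 +
      (z\<^sup>2 + b\<^sup>2 - a\<^sup>2) / a * - (pi / 2) + (z\<^sup>2 + a\<^sup>2 - b\<^sup>2) / b * - (pi / 2))) at_bot"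
      unfolding G_def by (intro tendsto_intros)
    moreover have "e * (z * 0 + u * - h + v * - h) = - (e * (u * h + v * h))" for e u v h
      by (simp add: algebra_simps)
    ultimately show ?thesis by (simp only: T_def)
  qed
  have f_nonneg: "0 \<le> f x" for x
    using assms by (simp add: f_def cauchy_density_nonneg)
  have cont: "isCont f x" for x
    unfolding f_def[abs_def] cauchy_density_def
    using pos(1)[of x] pos(2)[of x]
    by (intro continuous_intros) (simp_all only: mult_eq_0_iff pi_neq_zero less_imp_neq[symmetric] simp_thms)
  \<comment> \<open>Since \<open>f\<close> is nonnegative and \<open>G\<close> has finite limits,
    integrability comes together with the value.\<close>
  have FTC: "set_integrable lborel (einterval (-\<infinity>) \<infinity>) f"
    "(LBINT x=-\<infinity>..\<infinity>. f x) = T - (- T)"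
    by (rule interval_integral_FTC_nonneg[where F = G];
        use deriv top bot f_nonneg cont in \<open>simp add: ereal_tendsto_simps\<close>)+
  have int: "integrable lborel f" "(LINT x|lborel. f x) = 2 * T"
    using FTC by (simp_all add: set_integrable_def einterval_def
        interval_lebesgue_integral_def set_lebesgue_integral_def)
  have "2 * T = cauchy_density (a + b) z"
  proof -
    \<comment> \<open>The factor \<open>(a - b)\<^sup>2 + z\<^sup>2\<close> of the numerator also
      divides \<open>d\<close>; cancelling it leaves the Cauchy density of scale
      \<open>a + b\<close>.\<close>
    have "2 * T = ((a + b) * ((a - b)\<^sup>2 + z\<^sup>2)) / (pi * d)"
    proof -
      have "a * b * ((z\<^sup>2 + b\<^sup>2 - a\<^sup>2) / a + (z\<^sup>2 + a\<^sup>2 - b\<^sup>2) / b) = (a + b) * ((a - b)\<^sup>2 + z\<^sup>2)"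
        using assms by (simp add: field_simps power2_eq_square)
      moreover have "2 * T = a * b * ((z\<^sup>2 + b\<^sup>2 - a\<^sup>2) / a + (z\<^sup>2 + a\<^sup>2 - b\<^sup>2) / b) / (pi * d)"
      proof -
        have "2 * (a * b / (pi\<^sup>2 * d) * (u * (pi / 2) + v * (pi / 2))) = a * b * (u + v) / (pi * d)" for u v
          using d by (simp add: field_simps power2_eq_square)
        then show ?thesis by (simp only: T_def)
      qed
      ultimately show ?thesis by simp
    qed
    also have "\<dots> = cauchy_density (a + b) z"
      using assms by (simp add: d_def cauchy_density_def)
    finally show ?thesis .
  qed
  then have "ennreal (cauchy_density (a + b) z) = (\<integral>\<^sup>+x. ennreal (f x) \<partial>lborel)"
    using nn_integral_eq_integral[OF int(1)] int(2) f_nonneg by simp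
  also have "\<dots> = (\<integral>\<^sup>+x. ennreal (cauchy_density b (z - x)) * ennreal (cauchy_density a x) \<partial>lborel)"
    unfolding f_def using assms by (simp add: ennreal_mult cauchy_density_nonneg)
  finally show ?thesis ..
qed

text \<open>Densities need to agree only almost everywhere, which disposes of the point 0. Absolute
  values appear because the Cauchy law is symmetric.\<close>

lemma convolution_std_cauchy_scale:
  assumes "v \<noteq> 0" "w \<noteq> 0"
  shows "(distr std_cauchy borel (\<lambda>x. v * x) \<star> distr std_cauchy borel (\<lambda>x. w * x))
    = distr std_cauchy borel (\<lambda>x. (\<bar>v\<bar> + \<bar>w\<bar>) * x)"
proof -
  interpret prob_space std_cauchy by (rule prob_space_std_cauchy)
  have fin: "finite_measure (density lborel (cauchy_density \<bar>u\<bar>))" if "u \<noteq> 0" for u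
    unfolding distr_std_cauchy_scale[OF that, symmetric]
    by (intro finite_measure_distr) simp
  have "AE z in lborel. z \<noteq> (0::real)" by (rule AE_lborel_singleton)
  then have "AE z in lborel. (\<integral>\<^sup>+x. ennreal (cauchy_density \<bar>v\<bar> (z - x)) * ennreal (cauchy_density \<bar>w\<bar> x) \<partial>lborel)
     = ennreal (cauchy_density (\<bar>v\<bar> + \<bar>w\<bar>) z)"
    by eventually_elim (use assms in \<open>simp add: convolution_cauchy_density add.commute\<close>)
  then have "density lborel (\<lambda>z. \<integral>\<^sup>+x. ennreal (cauchy_density \<bar>v\<bar> (z - x)) * ennreal (cauchy_density \<bar>w\<bar> x) \<partial>lborel)
     = density lborel (cauchy_density (\<bar>v\<bar> + \<bar>w\<bar>))"
    by (intro density_cong) auto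
  then show ?thesis
    using assms distr_std_cauchy_scale[of "\<bar>v\<bar> + \<bar>w\<bar>"]
    by (simp add: distr_std_cauchy_scale convolution_density fin)
qed

text \<open>1-stability of the Cauchy law, by induction with one convolution for each new
  index.\<close>

lemma (in prob_space) distr_sum_indep_std_cauchy:
  assumes "finite I" "indep_vars (\<lambda>_. borel) X I"
    and "\<And>i. i \<in> I \<Longrightarrow> distr M borel (X i) = std_cauchy"
  shows "distr M borel (\<lambda>\<omega>. \<Sum>i\<in>I. v i * X i \<omega>) = distr std_cauchy borel (\<lambda>x. (\<Sum>i\<in>I. \<bar>v i\<bar>) * x)"
  using assms
proof (induction I rule: finite_induct)
  case empty
  interpret C: prob_space std_cauchy by (rule prob_space_std_cauchy)
  show ?case
  proof (rule measure_eqI)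
    fix A assume "A \<in> sets (distr M borel (\<lambda>\<omega>. \<Sum>i\<in>{}. v i * X i \<omega>))"
    then show "emeasure (distr M borel (\<lambda>\<omega>. \<Sum>i\<in>{}. v i * X i \<omega>)) A
        = emeasure (distr std_cauchy borel (\<lambda>x. (\<Sum>i\<in>{}. \<bar>v i\<bar>) * x)) A"
      using C.emeasure_space_1
      by (cases "0 \<in> A") (simp_all add: emeasure_distr emeasure_space_1 vimage_def)
  qed simp
next
  case (insert i I)
  have rv [measurable]: "j \<in> insert i I \<Longrightarrow> X j \<in> borel_measurable M" for j
    using insert.prems(1) by (auto simp: indep_vars_def)
  have IH: "distr M borel (\<lambda>\<omega>. \<Sum>i\<in>I. v i * X i \<omega>) = distr std_cauchy borel (\<lambda>x. (\<Sum>i\<in>I. \<bar>v i\<bar>) * x)"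
    using insert by (intro insert.IH) (auto intro: indep_vars_subset)
  have one: "distr M borel (\<lambda>\<omega>. v i * X i \<omega>) = distr std_cauchy borel (\<lambda>x. v i * x)"
  proof -
    have "distr (distr M borel (X i)) borel (\<lambda>x. v i * x) = distr M borel (\<lambda>\<omega>. v i * X i \<omega>)"
      by (subst distr_distr) (auto simp: comp_def)
    then show ?thesis using insert.prems(2) by simp
  qed
  have sum0: "(\<Sum>j\<in>I. \<bar>v j\<bar>) \<ge> 0" by (simp add: sum_nonneg)
  \<comment> \<open>The convolution formula requires two nonzero scales. A zero coefficient, or a
    partial sum whose coefficients are all zero, contributes nothing and is dropped instead.\<close>
  consider "v i = 0" | "(\<Sum>j\<in>I. \<bar>v j\<bar>) = 0" "v i \<noteq> 0" | "(\<Sum>j\<in>I. \<bar>v j\<bar>) > 0" "v i \<noteq> 0"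
    using sum0 by linarith
  then show ?case
  proof cases
    case 1
    then show ?thesis using IH insert by simp
  next
    case 2
    then have "v j = 0" if "j \<in> I" for j
      using that insert by (simp add: sum_nonneg_eq_0_iff)
    \<comment> \<open>By symmetry \<open>v i * X\<close> and \<open>\<bar>v i\<bar> * X\<close> have
      the same density.\<close>
    then show ?thesis using insert one distr_std_cauchy_scale[of "v i"] distr_std_cauchy_scale[of "\<bar>v i\<bar>"] 2
      by simp
  next
    case 3
    have "indep_vars (\<lambda>_. borel) (\<lambda>j \<omega>. v j * X j \<omega>) (insert i I)"
      by (rule indep_vars_compose2[OF insert.prems(1)]) simp
    then have "indep_var borel (\<lambda>\<omega>. v i * X i \<omega>) borel (\<lambda>\<omega>. \<Sum>j\<in>I. v j * X j \<omega>)"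
      using insert by (intro indep_vars_sum)
    then have "distr M borel (\<lambda>\<omega>. v i * X i \<omega> + (\<Sum>j\<in>I. v j * X j \<omega>))
      = (distr M borel (\<lambda>\<omega>. v i * X i \<omega>) \<star> distr M borel (\<lambda>\<omega>. \<Sum>j\<in>I. v j * X j \<omega>))"
      by (rule sum_indep_random_variable) measurable
    also have "\<dots> = distr std_cauchy borel (\<lambda>x. (\<bar>v i\<bar> + (\<Sum>j\<in>I. \<bar>v j\<bar>)) * x)"
      unfolding one IH using 3 by (subst convolution_std_cauchy_scale) auto
    finally show ?thesis using insert by simp
  qed
qed

section \<open>A Chernoff bound for the lower tail from a moment of order \<open>p\<close>\<close>

text \<open>For \<open>u\<close> in [0, 1],
  \<open>exp (- u) \<le> 1 / (1 + u) \<le> 1 - u + u\<^sup>2\<close>, and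
  \<open>u\<^sup>2 \<le> u powr p\<close> there. For \<open>u > 1\<close> the right-hand side is at
  least 1.\<close>

lemma exp_minus_le_powr:
  fixes u p :: real
  assumes "0 \<le> u" "1 < p" "p \<le> 2"
  shows "exp (- u) \<le> 1 - u + u powr p"
proof (cases "u \<le> 1")
  case True
  show ?thesis
  proof (cases "u = 0")
    case False
    then have u: "u > 0" using assms by simp
    have "exp (- u) = 1 / exp u" by (simp add: exp_minus inverse_eq_divide)
    also have "\<dots> \<le> 1 / (1 + u)"
      using u by (intro divide_left_mono) auto
    also have "\<dots> \<le> 1 - u + u\<^sup>2"
    proof -
      have "(1 - u + u\<^sup>2) * (1 + u) = 1 + u ^ 3" by (simp add: power2_eq_square power3_eq_cube algebra_simps)
      then show ?thesis using u by (simp add: pos_divide_le_eq)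
    qed
    also have "u\<^sup>2 = u powr 2" using u by simp
    also have "u powr 2 \<le> u powr p" using u True assms by (intro powr_mono') auto
    finally show ?thesis by simp
  qed simp
next
  case False
  then have "u powr 1 \<le> u powr p" using assms by (intro powr_mono) auto
  then show ?thesis using False by (smt (verit) exp_le_one_iff powr_one)
qed

text \<open>Exponential Markov inequality applied to the negated sum, each Laplace transform being
  bounded through \<open>exp_minus_le_powr\<close>. The parameter \<open>s\<close> stays free, to be
  optimised later.\<close>

lemma (in prob_space) sum_lower_tail_powr:
  fixes Z :: "'i \<Rightarrow> 'a \<Rightarrow> real" and a p s b \<epsilon> :: real
  assumes I: "finite I" and indep: "indep_vars (\<lambda>_. borel) Z I"
    and nonneg: "\<And>i \<omega>. i \<in> I \<Longrightarrow> 0 \<le> Z i \<omega>"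
    and integrable: "\<And>i. i \<in> I \<Longrightarrow> integrable M (Z i)"
    and mean: "\<And>i. i \<in> I \<Longrightarrow> expectation (Z i) = a"
    and integrable_p: "\<And>i. i \<in> I \<Longrightarrow> integrable M (\<lambda>\<omega>. Z i \<omega> powr p)"
    and moment: "\<And>i. i \<in> I \<Longrightarrow> expectation (\<lambda>\<omega>. Z i \<omega> powr p) \<le> b * a powr p"
    and a: "a > 0" and p: "1 < p" "p \<le> 2" and s: "s > 0"
  shows "prob {\<omega> \<in> space M. (\<Sum>i\<in>I. Z i \<omega>) \<le> (1 - \<epsilon>) * (real (card I) * a)}
    \<le> exp (real (card I) * (s powr p * b - s * \<epsilon>))"
proof -
  \<comment> \<open>Dividing by the mean makes the estimate scale-free: \<open>t * a = s\<close>,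
    and \<open>t powr p\<close> cancels the factor \<open>a powr p\<close> of the moment
    bound.\<close>
  define t where "t = s / a"
  have t: "t > 0" using a s by (simp add: t_def)
  have [measurable]: "i \<in> I \<Longrightarrow> Z i \<in> borel_measurable M" for i
    using indep by (auto simp: indep_vars_def)
  have int_exp: "integrable M (\<lambda>\<omega>. exp (- t * Z i \<omega>))" if "i \<in> I" for i
    by (rule integrable_const_bound[where B = 1]) (use that nonneg t in auto)
  have indep_exp: "indep_vars (\<lambda>_. borel) (\<lambda>i \<omega>. exp (- t * Z i \<omega>)) I"
    by (rule indep_vars_compose2[OF indep]) simp
  have mgf: "expectation (\<lambda>\<omega>. exp (- t * Z i \<omega>)) \<le> exp (- s + s powr p * b)" if i: "i \<in> I" for i
  proof -
    have "exp (- t * Z i \<omega>) \<le> 1 - t * Z i \<omega> + t powr p * Z i \<omega> powr p" for \<omega>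
      using exp_minus_le_powr[of "t * Z i \<omega>" p] nonneg[OF i] t p by (simp add: powr_mult)
    then have "expectation (\<lambda>\<omega>. exp (- t * Z i \<omega>))
        \<le> expectation (\<lambda>\<omega>. 1 - t * Z i \<omega> + t powr p * Z i \<omega> powr p)"
      using i integrable integrable_p int_exp by (intro integral_mono) auto
    also have "\<dots> = 1 - t * a + t powr p * expectation (\<lambda>\<omega>. Z i \<omega> powr p)"
      using i integrable integrable_p mean by (simp add: prob_space)
    also have "\<dots> \<le> 1 - t * a + t powr p * (b * a powr p)"
      using moment[OF i] by (intro add_left_mono mult_left_mono) auto
    also have "\<dots> = 1 + (- s + s powr p * b)"
      using a s by (simp add: t_def powr_divide)
    also have "\<dots> \<le> exp (- s + s powr p * b)" by (rule exp_ge_add_one_self)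
    finally show ?thesis .
  qed
  have exp_sum: "exp (- t * (\<Sum>i\<in>I. Z i \<omega>)) = (\<Prod>i\<in>I. exp (- t * Z i \<omega>))" for \<omega>
    by (simp add: sum_distrib_left exp_sum I sum_negf[symmetric])
  have "prob {\<omega> \<in> space M. (\<Sum>i\<in>I. Z i \<omega>) \<le> (1 - \<epsilon>) * (real (card I) * a)}
     \<le> exp (t * ((1 - \<epsilon>) * (real (card I) * a))) * expectation (\<lambda>\<omega>. exp (- t * (\<Sum>i\<in>I. Z i \<omega>)))"
  proof -
    have int: "integrable M (\<lambda>\<omega>. exp (- t * (\<Sum>i\<in>I. Z i \<omega>)))"
      unfolding exp_sum by (rule indep_vars_integrable[OF I indep_exp]) (rule int_exp)
    then have "set_integrable M (space M) (\<lambda>\<omega>. exp (- t * (\<Sum>i\<in>I. Z i \<omega>)))"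
      unfolding set_integrable_def by (intro integrable_mult_indicator) auto
    from Chernoff_ineq_le[OF t this] show ?thesis
      using set_integral_space[OF int] by simp
  qed
  also have "expectation (\<lambda>\<omega>. exp (- t * (\<Sum>i\<in>I. Z i \<omega>))) = (\<Prod>i\<in>I. expectation (\<lambda>\<omega>. exp (- t * Z i \<omega>)))"
    unfolding exp_sum by (rule indep_vars_lebesgue_integral[OF I indep_exp]) (rule int_exp)
  also have "\<dots> \<le> (\<Prod>i\<in>I. exp (- s + s powr p * b))"
    using mgf by (intro prod_mono) auto
  also have "exp (t * ((1 - \<epsilon>) * (real (card I) * a))) * (\<Prod>i\<in>I. exp (- s + s powr p * b))
      = exp (real (card I) * (s powr p * b - s * \<epsilon>))"
    using a by (simp add: t_def exp_of_nat_mult[symmetric] exp_add[symmetric] algebra_simps)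
  finally show ?thesis by simp
qed

section \<open>Estimates for \<open>\<xi>\<close>, its moments and \<open>\<mu>\<close>\<close>

lemma \<xi>_nonneg: "0 \<le> l \<Longrightarrow> 0 \<le> \<xi> l"
  by (simp add: \<xi>_def)

lemma borel_measurable_\<xi> [measurable]: "\<xi> \<in> borel_measurable borel"
  unfolding \<xi>_def by measurable

lemma \<xi>_0 [simp]: "\<xi> 0 = 0"
  by (simp add: \<xi>_def)

text \<open>As \<open>1 + l \<le> (1 + sqrt l)\<^sup>2\<close>, the second summand of
  \<open>\<xi>\<close> is at most the first. Square root growth reduces the moment of order
  \<open>p\<close> of \<open>\<xi> (l * \<bar>X\<bar>)\<close> to the moment of order
  \<open>p / 2 < 1\<close> of the Cauchy law, which is finite.\<close>

lemma \<xi>_le: "0 \<le> l \<Longrightarrow> \<xi> l \<le> 2 * sqrt l"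
proof -
  assume l: "0 \<le> l"
  have "1 + l \<le> (1 + sqrt l)\<^sup>2" using l by (simp add: power2_sum)
  then have "ln (1 + l) \<le> ln ((1 + sqrt l)\<^sup>2)" using l by (intro ln_mono) auto
  also have "\<dots> = 2 * ln (1 + sqrt l)" using l by (simp add: ln_realpow)
  finally have "\<xi> l \<le> 2 * ln (1 + sqrt l)" by (simp add: \<xi>_def)
  also have "\<dots> \<le> 2 * sqrt l" using l ln_add_one_self_le_self[of "sqrt l"] by simp
  finally show ?thesis .
qed

lemma nn_integral_std_cauchy:
  assumes [measurable]: "f \<in> borel_measurable borel"
  shows "(\<integral>\<^sup>+x. f x \<partial>std_cauchy) = (\<integral>\<^sup>+x. ennreal (cauchy_density 1 x) * f x \<partial>lborel)"
  unfolding std_cauchy_eq_density by (subst nn_integral_density) auto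

text \<open>For \<open>\<bar>x\<bar> < 1\<close> the integrand is at most the density, whose total
  mass is 1. Elsewhere the density is at most \<open>1 / 2 * \<bar>x\<bar> powr (- 2)\<close>, so
  each of the two tails contributes at most half of \<open>1 / (1 - q)\<close>. This blow-up as
  \<open>q\<close> tends to 1 is the source of the factor of order \<open>L\<close>.\<close>

lemma nn_integral_std_cauchy_powr_le:
  assumes q: "0 < q" "q < 1"
  shows "(\<integral>\<^sup>+x. ennreal (\<bar>x\<bar> powr q) \<partial>std_cauchy) \<le> ennreal (1 + 1 / (1 - q))"
proof -
  have half: "(\<integral>\<^sup>+x. ennreal (x powr (q - 2)) * indicator {1..} x \<partial>lborel) = ennreal (1 / (1 - q))"
  proof -
    have "(\<integral>\<^sup>+x. ennreal (x powr (q - 2)) * indicator {1..} x \<partial>lborel)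
        = ennreal (0 - 1 powr (q - 1) / (q - 1))"
    proof (rule nn_integral_FTC_atLeast[where F = "\<lambda>x. x powr (q - 1) / (q - 1)"])
      fix x :: real assume "1 \<le> x"
      then show "((\<lambda>x. x powr (q - 1) / (q - 1)) has_real_derivative x powr (q - 2)) (at x)"
        using q by (auto intro!: derivative_eq_intros)
    next
      show "((\<lambda>x. x powr (q - 1) / (q - 1)) \<longlongrightarrow> 0) at_top"
        using q by real_asymp
    qed auto
    also have "0 - 1 powr (q - 1) / (q - 1) = 1 / (1 - q)" using q by (simp add: field_simps)
    finally show ?thesis .
  qed
  have refl: "(\<integral>\<^sup>+x. ennreal (\<bar>x\<bar> powr (q - 2)) * indicator {..-1} x \<partial>lborel)
     = (\<integral>\<^sup>+x. ennreal (x powr (q - 2)) * indicator {1..} x \<partial>lborel)"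
    by (subst nn_integral_real_affine[where c = "-1" and t = 0])
       (auto intro!: nn_integral_cong split: split_indicator)
  have "ennreal (cauchy_density 1 x) * ennreal (\<bar>x\<bar> powr q) \<le>
      ennreal (cauchy_density 1 x) + ennreal (1 / 2) * (ennreal (x powr (q - 2)) * indicator {1..} x
        + ennreal (\<bar>x\<bar> powr (q - 2)) * indicator {..-1} x)" for x :: real
  proof (cases "\<bar>x\<bar> < 1")
    case True
    then have "\<bar>x\<bar> powr q \<le> 1" using q by (intro powr_le1) auto
    then have "ennreal (cauchy_density 1 x) * ennreal (\<bar>x\<bar> powr q) \<le> ennreal (cauchy_density 1 x) * 1"
      by (intro mult_left_mono) auto
    then show ?thesis by (simp add: add_increasing2)
  next
    case False
    have "cauchy_density 1 x \<le> 1 / 2 * \<bar>x\<bar> powr (- 2)"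
    proof -
      have "2 * x\<^sup>2 \<le> pi * (1\<^sup>2 + x\<^sup>2)"
        using pi_gt3 by (intro mult_mono) auto
      moreover have "\<bar>x\<bar> powr (- 2) = 1 / x\<^sup>2" using False by (simp add: powr_minus_divide)
      ultimately show ?thesis
        using False by (auto simp: cauchy_density_def intro!: divide_left_mono mult_pos_pos add_pos_nonneg)
    qed
    then have "cauchy_density 1 x * \<bar>x\<bar> powr q \<le> 1 / 2 * \<bar>x\<bar> powr (- 2) * \<bar>x\<bar> powr q"
      by (intro mult_right_mono) auto
    also have "\<dots> = 1 / 2 * \<bar>x\<bar> powr (q - 2)"
      by (simp add: powr_add[symmetric])
    finally have "ennreal (cauchy_density 1 x) * ennreal (\<bar>x\<bar> powr q) \<le> ennreal (1 / 2) * ennreal (\<bar>x\<bar> powr (q - 2))"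
      by (simp add: ennreal_mult[symmetric] cauchy_density_nonneg ennreal_leI del: ennreal_half)
    then show ?thesis using False
      by (auto split: split_indicator simp: abs_if intro: add_increasing)
  qed
  then have "(\<integral>\<^sup>+x. ennreal (\<bar>x\<bar> powr q) \<partial>std_cauchy) \<le>
      (\<integral>\<^sup>+x. ennreal (cauchy_density 1 x) + ennreal (1 / 2) * (ennreal (x powr (q - 2)) * indicator {1..} x
        + ennreal (\<bar>x\<bar> powr (q - 2)) * indicator {..-1} x) \<partial>lborel)"
    by (subst nn_integral_std_cauchy) (auto intro: nn_integral_mono)
  also have "\<dots> = (\<integral>\<^sup>+x. ennreal (cauchy_density 1 x) \<partial>lborel)
      + ennreal (1 / 2) * (ennreal (1 / (1 - q)) + ennreal (1 / (1 - q)))"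
    by (simp add: nn_integral_add nn_integral_cmult refl half del: ennreal_half)
  also have "(\<integral>\<^sup>+x. ennreal (cauchy_density 1 x) \<partial>lborel) = 1"
    using prob_space.emeasure_space_1[OF prob_space_std_cauchy]
    by (simp add: std_cauchy_eq_density emeasure_density)
  also have "1 + ennreal (1 / 2) * (ennreal (1 / (1 - q)) + ennreal (1 / (1 - q))) = ennreal (1 + 1 / (1 - q))"
    using q by (simp add: ennreal_plus[symmetric] ennreal_mult[symmetric] ennreal_1[symmetric] del: ennreal_plus ennreal_half ennreal_1)
  finally show ?thesis .
qed

lemma std_cauchy_powr:
  assumes q: "0 < q" "q < 1"
  shows integrable_std_cauchy_powr: "integrable std_cauchy (\<lambda>x. \<bar>x\<bar> powr q)"
    and integral_std_cauchy_powr_le: "(LINT x|std_cauchy. \<bar>x\<bar> powr q) \<le> 1 + 1 / (1 - q)"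
proof -
  note bound = nn_integral_std_cauchy_powr_le[OF q]
  show int: "integrable std_cauchy (\<lambda>x. \<bar>x\<bar> powr q)"
    using order.strict_trans1[OF bound] by (intro integrableI_nonneg) auto
  show "(LINT x|std_cauchy. \<bar>x\<bar> powr q) \<le> 1 + 1 / (1 - q)"
    using bound q by (simp add: nn_integral_eq_integral[OF int] ennreal_le_iff del: ennreal_plus)
qed

lemma \<xi>_powr_le:
  assumes "0 \<le> l" "0 < p"
  shows "\<xi> (l * \<bar>x\<bar>) powr p \<le> 2 powr p * l powr (p / 2) * \<bar>x\<bar> powr (p / 2)"
proof -
  have "\<xi> (l * \<bar>x\<bar>) powr p \<le> (2 * sqrt (l * \<bar>x\<bar>)) powr p"
    using assms by (intro powr_mono2 \<xi>_le \<xi>_nonneg) auto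
  also have "\<dots> = 2 powr p * l powr (p / 2) * \<bar>x\<bar> powr (p / 2)"
    using assms by (simp add: powr_mult powr_half_sqrt[symmetric] powr_powr)
  finally show ?thesis .
qed

lemma integrable_\<xi>_powr:
  assumes "0 \<le> l" "0 < p" "p < 2"
  shows "integrable std_cauchy (\<lambda>x. \<xi> (l * \<bar>x\<bar>) powr p)"
proof (rule Bochner_Integration.integrable_bound)
  show "integrable std_cauchy (\<lambda>x. 2 powr p * l powr (p / 2) * \<bar>x\<bar> powr (p / 2))"
    using assms by (intro integrable_mult_right integrable_std_cauchy_powr) auto
  show "AE x in std_cauchy. norm (\<xi> (l * \<bar>x\<bar>) powr p) \<le> norm (2 powr p * l powr (p / 2) * \<bar>x\<bar> powr (p / 2))"
    using \<xi>_powr_le[OF assms(1,2)] by simp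
qed measurable

lemma integrable_\<xi>:
  assumes "0 \<le> l"
  shows "integrable std_cauchy (\<lambda>x. \<xi> (l * \<bar>x\<bar>))"
  using integrable_\<xi>_powr[of l 1] assms by (simp add: \<xi>_nonneg)

lemma integral_\<xi>_powr_le:
  assumes "0 \<le> l" "0 < p" "p < 2"
  shows "(LINT x|std_cauchy. \<xi> (l * \<bar>x\<bar>) powr p) \<le> 2 powr p * l powr (p / 2) * (1 + 1 / (1 - p / 2))"
proof -
  have "(LINT x|std_cauchy. \<xi> (l * \<bar>x\<bar>) powr p) \<le> (LINT x|std_cauchy. 2 powr p * l powr (p / 2) * \<bar>x\<bar> powr (p / 2))"
    using assms by (intro integral_mono integrable_\<xi>_powr integrable_mult_right integrable_std_cauchy_powr \<xi>_powr_le) auto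
  also have "\<dots> = 2 powr p * l powr (p / 2) * (LINT x|std_cauchy. \<bar>x\<bar> powr (p / 2))" by simp
  also have "\<dots> \<le> 2 powr p * l powr (p / 2) * (1 + 1 / (1 - p / 2))"
    using assms by (intro mult_left_mono integral_std_cauchy_powr_le) auto
  finally show ?thesis .
qed

text \<open>Only the event that \<open>X\<close> lies in [1, 2] is kept. The density there is at
  least 1/20, because \<open>pi < 4\<close> and \<open>1 + x\<^sup>2 \<le> 5\<close>; and
  \<open>\<xi> (l * \<bar>x\<bar>) \<ge> ln (1 + sqrt l) \<ge> 2 / 5 * sqrt l\<close>. The product
  of 2/5 and 1/20 is 1/50.\<close>

lemma \<mu>_ge:
  assumes "0 \<le> l" "l \<le> 2"
  shows "sqrt l / 50 \<le> \<mu> l"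
proof -
  interpret prob_space std_cauchy by (rule prob_space_std_cauchy)
  have prob: "prob {1..2} \<ge> 1 / 20"
  proof -
    have "ennreal (1 / 20) = (\<integral>\<^sup>+x. ennreal (1 / 20) * indicator {1..2::real} x \<partial>lborel)"
      by (subst nn_integral_cmult_indicator) auto
    also have "\<dots> \<le> (\<integral>\<^sup>+x. ennreal (cauchy_density 1 x) * indicator {1..2} x \<partial>lborel)"
    proof (rule nn_integral_mono)
      fix x :: real
      show "ennreal (1 / 20) * indicator {1..2} x \<le> ennreal (cauchy_density 1 x) * indicator {1..2} x"
      proof (cases "x \<in> {1..2}")
        case True
        have "pi * (1\<^sup>2 + x\<^sup>2) \<le> 4 * (1\<^sup>2 + 2\<^sup>2)"
          using pi_less_4 True by (intro mult_mono add_mono power_mono) auto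
        then have "1 / 20 \<le> cauchy_density 1 x"
          unfolding cauchy_density_def by (intro divide_left_mono) (auto intro!: mult_pos_pos add_pos_nonneg)
        then show ?thesis using True by (simp add: ennreal_leI)
      qed simp
    qed
    also have "\<dots> = emeasure std_cauchy {1..2}"
      by (simp add: std_cauchy_eq_density emeasure_density)
    finally show ?thesis by (simp add: emeasure_eq_measure)
  qed
  have "2 / 5 * sqrt l * indicator {1..2} x \<le> \<xi> (l * \<bar>x\<bar>)" for x
  proof (cases "x \<in> {1..2}")
    case True
    \<comment> \<open>The bound 3/2 makes \<open>1 + sqrt l\<close> at most 5/2, hence the constant
      2/5.\<close>
    have "sqrt l \<le> sqrt ((3 / 2)\<^sup>2)" using assms by (intro real_sqrt_le_mono) (simp add: power2_eq_square)
    then have le: "sqrt l \<le> 3 / 2" by simp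
    have "2 / 5 * sqrt l = sqrt l / (5 / 2)" by simp
    also have "\<dots> \<le> sqrt l / (1 + sqrt l)"
      using le assms by (intro divide_left_mono) (simp_all add: add_pos_nonneg)
    also have "\<dots> \<le> ln (sqrt l + 1)" using assms by (intro ln_add1_ge) auto
    also have "\<dots> \<le> ln (1 + sqrt (l * \<bar>x\<bar>))"
    proof -
      have "l * 1 \<le> l * \<bar>x\<bar>" using True assms by (intro mult_left_mono) auto
      then show ?thesis using assms by (intro ln_mono) (simp_all add: add_nonneg_pos)
    qed
    also have "\<dots> \<le> \<xi> (l * \<bar>x\<bar>)" using assms by (simp add: \<xi>_def)
    finally show ?thesis using True by simp
  qed (use assms in \<open>auto intro: \<xi>_nonneg\<close>)
  then have "(LINT x|std_cauchy. 2 / 5 * sqrt l * indicator {1..2} x) \<le> \<mu> l"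
    unfolding \<mu>_def using assms
    by (intro integral_mono integrable_\<xi> integrable_mult_right integrable_real_indicator) (auto simp: emeasure_eq_measure)
  moreover have "(LINT x|std_cauchy. 2 / 5 * sqrt l * indicator {1..2} x) = 2 / 5 * sqrt l * prob {1..2}"
    by simp
  moreover have "2 / 5 * sqrt l * (1 / 20) \<le> 2 / 5 * sqrt l * prob {1..2}"
    using prob assms by (intro mult_left_mono) auto
  ultimately show ?thesis by simp
qed

section \<open>Choice of the Chernoff parameter and comparison of the moment with the mean\<close>

text \<open>The constants are \<open>50000 = 2\<^sup>2 * 50\<^sup>2 * 5\<close>, from \<open>\<xi> l \<le> 2 * sqrt l\<close>, \<open>sqrt l / 50 \<le> \<mu> l\<close> and
  \<open>1 + 1 / (1 - p / 2) \<le> 5 * L\<close>, and \<open>300000 = 6 * 50000\<close>, the 6 being twice a bound for \<open>exp 1\<close>.\<close>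

lemma lower_tail_parameters:
  fixes L \<epsilon> :: real
  assumes L: "1 \<le> L" and \<epsilon>: "exp (- L / 2) \<le> \<epsilon>"
  defines "s \<equiv> \<epsilon> / (300000\<^sup>2 * L)"
  shows "s powr (2 - 1 / (2 * L)) * (50000 * L) - s * \<epsilon> \<le> - (s * \<epsilon> / 2)"
proof -
  have \<epsilon>0: "\<epsilon> > 0" using \<epsilon> exp_gt_zero[of "- L / 2"] by linarith
  have s: "s > 0" using L \<epsilon>0 by (simp add: s_def)
  \<comment> \<open>Aim: \<open>s powr (- 1 / (2 * L)) = exp (- ln s / (2 * L))\<close> is bounded
    by a constant. Since \<open>ln L \<le> L\<close> and \<open>ln \<epsilon> \<ge> - L / 2\<close>,
    the quantity \<open>- ln s\<close> grows at most linearly in \<open>L\<close>.\<close>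
  have "- ln s = 2 * ln 300000 + ln L - ln \<epsilon>"
    using L \<epsilon>0 ln_realpow[of 300000 2] by (simp add: s_def ln_divide_pos ln_mult_pos)
  also have "\<dots> \<le> 2 * ln 300000 + L + L / 2"
  proof -
    have "ln L \<le> L" using ln_le_minus_one[of L] L by linarith
    moreover have "- L / 2 \<le> ln \<epsilon>" using \<epsilon> \<epsilon>0 by (simp add: ln_ge_iff)
    ultimately show ?thesis by linarith
  qed
  finally have "- ln s / (2 * L) \<le> (2 * ln 300000 + L + L / 2) / (2 * L)"
    using L by (intro divide_right_mono) auto
  also have "\<dots> = ln 300000 / L + 3 / 4" using L by (simp add: field_simps)
  also have "\<dots> \<le> ln 300000 + 1"
  proof -
    have "ln 300000 / L \<le> ln 300000 / 1" using L by (intro divide_left_mono) auto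
    then show ?thesis by simp
  qed
  finally have "exp (- ln s / (2 * L)) \<le> exp (ln 300000 + 1)" by simp
  also have "\<dots> \<le> 300000 * 3" using exp_le by (simp add: exp_add)
  finally have "s powr (- 1 / (2 * L)) \<le> 900000" using s by (simp add: powr_def)
  have "s powr (2 - 1 / (2 * L)) = s powr 2 * s powr (- 1 / (2 * L))"
    unfolding powr_add[symmetric] by simp
  also have "\<dots> \<le> s powr 2 * 900000"
    by (intro mult_left_mono) (fact, simp)
  \<comment> \<open>One factor \<open>s\<close> is replaced by its definition, with
    \<open>900000 / 300000\<^sup>2 = 1 / 100000\<close>. Multiplied by \<open>50000 * L\<close> this
    leaves half of \<open>s * \<epsilon>\<close>.\<close>
  also have "\<dots> = s * \<epsilon> / (100000 * L)"
    using s L by (simp add: power2_eq_square) (simp add: s_def field_simps)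
  finally have "s powr (2 - 1 / (2 * L)) * (50000 * L) \<le> s * \<epsilon> / (100000 * L) * (50000 * L)"
    using L by (intro mult_right_mono) auto
  also have "\<dots> = s * \<epsilon> / 2" using L by simp
  finally show ?thesis by simp
qed

text \<open>The upper bound for the moment and the lower bound for \<open>\<mu> l powr p\<close> are
  both multiples of \<open>l powr (p / 2)\<close>, so \<open>l\<close> cancels and the constant is
  uniform as \<open>l\<close> tends to 0.\<close>

lemma integral_\<xi>_powr_le_\<mu>:
  fixes L l :: real
  assumes L: "1 \<le> L" and l: "0 < l" "l \<le> 2"
  defines "p \<equiv> 2 - 1 / (2 * L)"
  shows "(LINT x|std_cauchy. \<xi> (l * \<bar>x\<bar>) powr p) \<le> (50000 * L) * \<mu> l powr p"
proof -
  have p: "1 < p" "p < 2" using L by (auto simp: p_def field_simps)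
  have "(LINT x|std_cauchy. \<xi> (l * \<bar>x\<bar>) powr p) \<le> 2 powr p * l powr (p / 2) * (1 + 1 / (1 - p / 2))"
    using l p by (intro integral_\<xi>_powr_le) auto
  also have "l powr (p / 2) = 50 powr p * (sqrt l / 50) powr p"
    using l by (simp add: powr_half_sqrt[symmetric] powr_powr powr_divide)
  also have "2 powr p * (50 powr p * (sqrt l / 50) powr p) * (1 + 1 / (1 - p / 2))
      \<le> 2 powr 2 * (50 powr 2 * \<mu> l powr p) * (5 * L)"
  proof (intro mult_mono powr_mono powr_mono2 \<mu>_ge)
    have "1 - p / 2 = 1 / (4 * L)" using L by (simp add: p_def field_simps)
    then show "1 + 1 / (1 - p / 2) \<le> 5 * L" using L by simp
  qed (use p l L in \<open>auto simp: field_simps\<close>)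
  also have "\<dots> = (50000 * L) * \<mu> l powr p" by simp
  finally show ?thesis .
qed

section \<open>Entries and rows of the random matrix\<close>

lemma indep_vars_cauchy_entries:
  "prob_space.indep_vars (cauchy_entries k D) (\<lambda>_. borel) (\<lambda>ij A. A ij) ({..<k} \<times> {..<D})"
  and distr_cauchy_entries:
    "ij \<in> {..<k} \<times> {..<D} \<Longrightarrow> distr (cauchy_entries k D) borel (\<lambda>A. A ij) = std_cauchy"
  and prob_space_cauchy_entries: "prob_space (cauchy_entries k D)"
proof -
  interpret C: product_prob_space "\<lambda>_. std_cauchy" "{..<k} \<times> {..<D}"
    by (intro product_prob_spaceI prob_space_std_cauchy)
  show ps: "prob_space (cauchy_entries k D)"
    unfolding cauchy_entries_def by (rule C.P.prob_space_axioms)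
  interpret P: prob_space "cauchy_entries k D" by (rule ps)
  have sets: "sets (cauchy_entries k D) = sets (\<Pi>\<^sub>M ij \<in> {..<k} \<times> {..<D}. borel)"
    unfolding cauchy_entries_def by (intro sets_PiM_cong refl) simp
  have rv: "(\<lambda>A. A ij) \<in> borel_measurable (cauchy_entries k D)" if "ij \<in> {..<k} \<times> {..<D}" for ij
    unfolding measurable_cong_sets[OF sets refl] using that by (rule measurable_component_singleton)
  show distr: "distr (cauchy_entries k D) borel (\<lambda>A. A ij) = std_cauchy" if "ij \<in> {..<k} \<times> {..<D}" for ij
    using C.PiM_component[OF that] by (simp add: cauchy_entries_def cong: distr_cong)
  show "P.indep_vars (\<lambda>_. borel) (\<lambda>ij A. A ij) ({..<k} \<times> {..<D})"
  \<comment> \<open>Independence of an empty family is vacuous; otherwise it is read off from the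
    joint law being the product of the marginals, a criterion for nonempty index sets.\<close>
  proof (cases "{..<k} \<times> {..<D} = {}")
    case True
    show ?thesis unfolding True P.indep_vars_def P.indep_sets_def by simp
  next
    case False
    \<comment> \<open>Outcomes of the product space are extensional, so restricting them to the
      index set is the identity.\<close>
    have "distr (cauchy_entries k D) (\<Pi>\<^sub>M ij \<in> {..<k} \<times> {..<D}. borel) (\<lambda>A. \<lambda>ij\<in>{..<k} \<times> {..<D}. A ij)
        = distr (cauchy_entries k D) (cauchy_entries k D) (\<lambda>A. A)"
      by (intro distr_cong refl sets[symmetric]) (auto simp: cauchy_entries_def space_PiM)
    also have "\<dots> = (\<Pi>\<^sub>M ij \<in> {..<k} \<times> {..<D}. std_cauchy)"
      by (simp add: distr_id2 cauchy_entries_def)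
    also have "\<dots> = (\<Pi>\<^sub>M ij \<in> {..<k} \<times> {..<D}. distr (cauchy_entries k D) borel (\<lambda>A. A ij))"
      by (intro PiM_cong refl) (simp add: distr)
    finally show ?thesis
      using False rv by (subst P.indep_vars_iff_distr_eq_PiM') auto
  qed
qed

lemma mat_mult_vec_index_sum:
  fixes x :: "real vec"
  assumes "i < k" "x \<in> carrier_vec D"
  shows "(mat k D A *\<^sub>v x) $ i = (\<Sum>j<D. x $ j * A (i, j))"
  using assms by (auto simp: scalar_prod_def atLeast0LessThan mult.commute intro!: sum.cong)

lemma \<rho>_mat_mult_vec:
  assumes "x \<in> carrier_vec D" "y \<in> carrier_vec D"
  shows "\<rho> k (mat k D A *\<^sub>v x) (mat k D A *\<^sub>v y)
    = 1 / real k * (\<Sum>i<k. \<xi> \<bar>\<Sum>j<D. (x - y) $ j * A (i, j)\<bar>)"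
proof -
  have "(mat k D A *\<^sub>v x) $ i - (mat k D A *\<^sub>v y) $ i = (\<Sum>j<D. (x - y) $ j * A (i, j))" if "i < k" for i
    using that assms unfolding mat_mult_vec_index_sum[OF that assms(1)] mat_mult_vec_index_sum[OF that assms(2)]
    by (simp add: sum_subtractf[symmetric] left_diff_distrib)
  then show ?thesis unfolding \<rho>_def by simp
qed

text \<open>\<open>R i\<close> is coordinate \<open>i\<close> of the image of \<open>v\<close>.
  Different rows use disjoint blocks of entries, which gives independence; the law of a single row
  is 1-stability.\<close>

lemma
  fixes k D :: nat and v :: "nat \<Rightarrow> real"
  defines "R \<equiv> \<lambda>i A. \<Sum>j<D. v j * A (i, j)"
  shows indep_vars_rows: "prob_space.indep_vars (cauchy_entries k D) (\<lambda>_. borel) R {..<k}"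
    and distr_row: "\<And>i. i < k \<Longrightarrow>
      distr (cauchy_entries k D) borel (R i) = distr std_cauchy borel (\<lambda>x. (\<Sum>j<D. \<bar>v j\<bar>) * x)"
proof -
  interpret prob_space "cauchy_entries k D" by (rule prob_space_cauchy_entries)
  note indep = indep_vars_cauchy_entries[of k D]
  have "indep_vars (\<lambda>i. \<Pi>\<^sub>M ij \<in> {i} \<times> {..<D}. borel) (\<lambda>i A. restrict (\<lambda>ij. A ij) ({i} \<times> {..<D})) {..<k}"
    by (rule indep_vars_restrict[OF indep]) (auto simp: disjoint_family_on_def)
  then have "indep_vars (\<lambda>_. borel) (\<lambda>i A. (\<Sum>j<D. v j * restrict (\<lambda>ij. A ij) ({i} \<times> {..<D}) (i, j))) {..<k}"
    by (rule indep_vars_compose2[where Y = "\<lambda>i A. \<Sum>j<D. v j * A (i, j)"])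
       (intro borel_measurable_sum borel_measurable_times measurable_component_singleton, auto)
  then show "indep_vars (\<lambda>_. borel) R {..<k}"
    by (simp add: R_def)
  fix i assume i: "i < k"
  have "indep_vars (\<lambda>_. borel) (\<lambda>ij A. A ij) (Pair i ` {..<D})"
    using i by (intro indep_vars_subset[OF indep]) auto
  then have "distr (cauchy_entries k D) borel (\<lambda>A. \<Sum>ij\<in>Pair i ` {..<D}. v (snd ij) * A ij)
      = distr std_cauchy borel (\<lambda>x. (\<Sum>ij\<in>Pair i ` {..<D}. \<bar>v (snd ij)\<bar>) * x)"
    using i by (intro distr_sum_indep_std_cauchy distr_cauchy_entries) auto
  moreover have "(\<Sum>ij\<in>Pair i ` {..<D}. g ij) = (\<Sum>j<D. g (i, j))" for g :: "nat \<times> nat \<Rightarrow> real"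
    by (subst sum.reindex) (auto simp: inj_on_def)
  ultimately show "distr (cauchy_entries k D) borel (R i) = distr std_cauchy borel (\<lambda>x. (\<Sum>j<D. \<bar>v j\<bar>) * x)"
    by (simp add: R_def)
qed

section \<open>Failure probability for a single pair of points\<close>

lemma prob_row_sum_lower_tail:
  fixes k D :: nat and v :: "nat \<Rightarrow> real" and L \<epsilon> :: real
  defines "l \<equiv> \<Sum>j<D. \<bar>v j\<bar>"
  assumes l: "0 < l" "l \<le> 2" and L: "1 \<le> L" and \<epsilon>: "exp (- L / 2) \<le> \<epsilon>"
    and k: "2 * 300000\<^sup>2 * L\<^sup>2 / \<epsilon>\<^sup>2 \<le> real k"
  shows "measure (cauchy_entries k D) {A \<in> space (cauchy_entries k D).
      (\<Sum>i<k. \<xi> \<bar>\<Sum>j<D. v j * A (i, j)\<bar>) \<le> (1 - \<epsilon>) * (real k * \<mu> l)} \<le> exp (- L)"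
proof -
  interpret prob_space "cauchy_entries k D" by (rule prob_space_cauchy_entries)
  define p where "p = 2 - 1 / (2 * L)"
  define s where "s = \<epsilon> / (300000\<^sup>2 * L)"
  define Z where "Z i A = \<xi> \<bar>\<Sum>j<D. v j * A (i, j)\<bar>" for i and A :: "nat \<times> nat \<Rightarrow> real"
  have p: "1 < p" "p < 2" using L by (auto simp: p_def field_simps)
  have \<epsilon>0: "\<epsilon> > 0" using \<epsilon> exp_gt_zero[of "- L / 2"] by linarith
  have \<mu>0: "\<mu> l > 0" using \<mu>_ge[of l] l by (intro less_le_trans[OF _ \<mu>_ge[of l]]) auto
  have rv [measurable]: "(\<lambda>A. \<Sum>j<D. v j * A (i, j)) \<in> borel_measurable (cauchy_entries k D)" if "i < k" for i
    using indep_vars_rows[where k = k and D = D and v = v] that by (auto simp: indep_vars_def)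
  \<comment> \<open>Each row sum has the law of \<open>l * X\<close>, so integrals over the matrix
    space become integrals over \<open>std_cauchy\<close>.\<close>
  have transfer:
    "integrable (cauchy_entries k D) (\<lambda>A. g (\<Sum>j<D. v j * A (i, j))) \<longleftrightarrow> integrable std_cauchy (\<lambda>x. g (l * x))"
    "expectation (\<lambda>A. g (\<Sum>j<D. v j * A (i, j))) = (LINT x|std_cauchy. g (l * x))"
    if "i < k" and [measurable]: "g \<in> borel_measurable borel" for i and g :: "real \<Rightarrow> real"
    using integrable_distr_eq[of "\<lambda>A. \<Sum>j<D. v j * A (i, j)" "cauchy_entries k D" borel g]
      integrable_distr_eq[of "\<lambda>x. l * x" std_cauchy borel g]
      integral_distr[of "\<lambda>A. \<Sum>j<D. v j * A (i, j)" "cauchy_entries k D" borel g]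
      integral_distr[of "\<lambda>x. l * x" std_cauchy borel g]
      rv[OF that(1)] distr_row[OF that(1), of D v] by (auto simp: l_def)
  have abs_l: "\<bar>l * x\<bar> = l * \<bar>x\<bar>" for x using l by (simp add: abs_mult)
  have "prob {A \<in> space (cauchy_entries k D). (\<Sum>i<k. Z i A) \<le> (1 - \<epsilon>) * (real (card {..<k}) * \<mu> l)}
      \<le> exp (real (card {..<k}) * (s powr p * (50000 * L) - s * \<epsilon>))"
  proof (rule sum_lower_tail_powr)
    show "indep_vars (\<lambda>_. borel) Z {..<k}"
      unfolding Z_def by (rule indep_vars_compose2[OF indep_vars_rows]) measurable
    fix i assume "i \<in> {..<k}"
    then have i: "i < k" by simp
    show "integrable (cauchy_entries k D) (Z i)"
      unfolding Z_def using l by (subst transfer(1)[OF i]) (simp_all add: abs_l integrable_\<xi>)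
    show "expectation (Z i) = \<mu> l"
      unfolding Z_def by (subst transfer(2)[OF i]) (simp_all add: abs_l \<mu>_def)
    show "integrable (cauchy_entries k D) (\<lambda>A. Z i A powr p)"
      unfolding Z_def using l p
      by (subst transfer(1)[OF i, of "\<lambda>x. \<xi> \<bar>x\<bar> powr p"]) (simp_all add: abs_l integrable_\<xi>_powr)
    show "expectation (\<lambda>A. Z i A powr p) \<le> (50000 * L) * \<mu> l powr p"
      unfolding Z_def using integral_\<xi>_powr_le_\<mu>[OF L l]
      by (subst transfer(2)[OF i, of "\<lambda>x. \<xi> \<bar>x\<bar> powr p"]) (simp_all add: abs_l p_def)
  qed (use p \<mu>0 \<epsilon>0 L in \<open>auto simp: Z_def \<xi>_nonneg s_def\<close>)
  also have "\<dots> \<le> exp (- L)"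
  proof -
    have "real k * (s powr p * (50000 * L) - s * \<epsilon>) \<le> real k * - (s * \<epsilon> / 2)"
      unfolding p_def s_def using lower_tail_parameters[OF L \<epsilon>] by (intro mult_left_mono) auto
    \<comment> \<open>The lower bound on \<open>k\<close> is matched to \<open>s * \<epsilon> / 2 =
      \<epsilon>\<^sup>2 / (2 * 300000\<^sup>2 * L)\<close>: their product is exactly
      \<open>L\<close>.\<close>
    also have "\<dots> \<le> 2 * 300000\<^sup>2 * L\<^sup>2 / \<epsilon>\<^sup>2 * - (s * \<epsilon> / 2)"
      using k \<epsilon>0 L by (intro mult_right_mono_neg) (auto simp: s_def)
    also have "\<dots> = - L"
      using \<epsilon>0 L by (simp add: s_def power2_eq_square)
    finally show ?thesis by simp
  qed
  finally show ?thesis by (simp add: Z_def)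
qed

lemma \<mu>_nonneg: "0 \<le> l \<Longrightarrow> 0 \<le> \<mu> l"
  unfolding \<mu>_def by (intro integral_nonneg_AE AE_I2 \<xi>_nonneg) auto

lemma \<mu>_0 [simp]: "\<mu> 0 = 0"
  by (simp add: \<mu>_def)

lemma \<rho>_nonneg: "0 \<le> \<rho> k u v"
  by (simp add: \<rho>_def sum_nonneg \<xi>_nonneg)

lemma norm1_nonneg: "0 \<le> norm1 v"
  by (simp add: norm1_def sum_nonneg)

text \<open>By linearity \<open>\<rho>\<close> depends only on the row sums for
  \<open>x - y\<close>. As \<open>1 - \<epsilon>\<close> and \<open>\<mu>\<close> are nonnegative, a
  factor \<open>\<delta> \<le> 1\<close> only lowers the threshold, so the bad event lies inside
  that of the row sum bound.\<close>

lemma prob_\<rho>_lower_tail: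
  fixes k D :: nat and x y :: "real vec" and L \<epsilon> \<delta> :: real
  assumes xy: "x \<in> carrier_vec D" "y \<in> carrier_vec D" and lt2: "norm1 (x - y) < 2"
    and L: "1 \<le> L" and \<epsilon>: "exp (- L / 2) \<le> \<epsilon>" "\<epsilon> \<le> 1"
    and k: "2 * 300000\<^sup>2 * L\<^sup>2 / \<epsilon>\<^sup>2 \<le> real k" and \<delta>: "\<delta> \<le> 1"
  shows "{A \<in> space (cauchy_entries k D).
      (1 - \<epsilon>) * \<delta> * \<mu> (norm1 (x - y)) > \<rho> k (mat k D A *\<^sub>v x) (mat k D A *\<^sub>v y)}
        \<in> sets (cauchy_entries k D)" (is "?bad \<in> _")
    and "measure (cauchy_entries k D) {A \<in> space (cauchy_entries k D).
      (1 - \<epsilon>) * \<delta> * \<mu> (norm1 (x - y)) > \<rho> k (mat k D A *\<^sub>v x) (mat k D A *\<^sub>v y)} \<le> exp (- L)"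
proof -
  interpret prob_space "cauchy_entries k D" by (rule prob_space_cauchy_entries)
  define v where "v j = (x - y) $ j" for j
  have norm1: "norm1 (x - y) = (\<Sum>j<D. \<bar>v j\<bar>)"
    using xy by (simp add: norm1_def v_def)
  have \<rho>: "\<rho> k (mat k D A *\<^sub>v x) (mat k D A *\<^sub>v y) = 1 / real k * (\<Sum>i<k. \<xi> \<bar>\<Sum>j<D. v j * A (i, j)\<bar>)" for A
    unfolding v_def by (rule \<rho>_mat_mult_vec[OF xy])
  have rv [measurable]: "(\<lambda>A. \<Sum>j<D. v j * A (i, j)) \<in> borel_measurable (cauchy_entries k D)" if "i < k" for i
    using indep_vars_rows[where k = k and D = D and v = v] that by (auto simp: indep_vars_def)
  have [measurable]: "(\<lambda>A. \<Sum>i<k. \<xi> \<bar>\<Sum>j<D. v j * A (i, j)\<bar>) \<in> borel_measurable (cauchy_entries k D)"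
    by (intro borel_measurable_sum) simp
  show "?bad \<in> sets (cauchy_entries k D)"
    unfolding \<rho> by measurable
  have \<epsilon>0: "\<epsilon> > 0" using \<epsilon> exp_gt_zero[of "- L / 2"] by linarith
  have "2 * 300000\<^sup>2 * L\<^sup>2 / \<epsilon>\<^sup>2 > 0" using L \<epsilon>0 by simp
  with k have k0: "real k > 0" by linarith
  show "measure (cauchy_entries k D) ?bad \<le> exp (- L)"
  \<comment> \<open>At distance 0, in particular for \<open>x = y\<close>, the threshold is
    \<open>\<mu> 0 = 0\<close> and no outcome is bad; the row sum bound requires a positive
    distance.\<close>
  proof (cases "norm1 (x - y) = 0")
    case True
    have "?bad = {}" using \<rho>_nonneg by (auto simp: True not_less)
    then show ?thesis by (metis exp_ge_zero measure_empty)
  next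
    case False
    have "?bad \<subseteq> {A \<in> space (cauchy_entries k D).
        (\<Sum>i<k. \<xi> \<bar>\<Sum>j<D. v j * A (i, j)\<bar>) \<le> (1 - \<epsilon>) * (real k * \<mu> (\<Sum>j<D. \<bar>v j\<bar>))}"
    proof safe
      fix A assume "\<rho> k (mat k D A *\<^sub>v x) (mat k D A *\<^sub>v y) < (1 - \<epsilon>) * \<delta> * \<mu> (norm1 (x - y))"
      also have "\<dots> \<le> (1 - \<epsilon>) * 1 * \<mu> (norm1 (x - y))"
        using \<epsilon> \<delta> by (intro mult_right_mono mult_left_mono \<mu>_nonneg norm1_nonneg) auto
      finally show "(\<Sum>i<k. \<xi> \<bar>\<Sum>j<D. v j * A (i, j)\<bar>) \<le> (1 - \<epsilon>) * (real k * \<mu> (\<Sum>j<D. \<bar>v j\<bar>))"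
        using k0 unfolding \<rho> norm1 by (simp add: field_simps)
    qed
    then have "prob ?bad \<le> prob {A \<in> space (cauchy_entries k D).
        (\<Sum>i<k. \<xi> \<bar>\<Sum>j<D. v j * A (i, j)\<bar>) \<le> (1 - \<epsilon>) * (real k * \<mu> (\<Sum>j<D. \<bar>v j\<bar>))}"
      by (rule finite_measure_mono) measurable
    also have "\<dots> \<le> exp (- L)"
    proof -
      have "0 < norm1 (x - y)" using False norm1_nonneg[of "x - y"] by linarith
      then show ?thesis
        using lt2 L \<epsilon> k unfolding norm1 by (intro prob_row_sum_lower_tail) auto
    qed
    finally show ?thesis .
  qed
qed

section \<open>Union bound over all pairs\<close>

lemma (in prob_space) prob_all_ge:
  assumes "finite Q" "\<And>q. q \<in> Q \<Longrightarrow> {\<omega> \<in> space M. \<not> G q \<omega>} \<in> events"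
    and "\<And>q. q \<in> Q \<Longrightarrow> prob {\<omega> \<in> space M. \<not> G q \<omega>} \<le> \<eta>"
  shows "1 - real (card Q) * \<eta> \<le> prob {\<omega> \<in> space M. \<forall>q\<in>Q. G q \<omega>}"
proof -
  have "prob (\<Union>q\<in>Q. {\<omega> \<in> space M. \<not> G q \<omega>}) \<le> (\<Sum>q\<in>Q. prob {\<omega> \<in> space M. \<not> G q \<omega>})"
    using assms by (intro finite_measure_subadditive_finite) auto
  also have "\<dots> \<le> real (card Q) * \<eta>"
    using assms(3) by (rule sum_bounded_above)
  finally have "1 - real (card Q) * \<eta> \<le> 1 - prob (\<Union>q\<in>Q. {\<omega> \<in> space M. \<not> G q \<omega>})" by simp
  also have "\<dots> = prob (space M - (\<Union>q\<in>Q. {\<omega> \<in> space M. \<not> G q \<omega>}))"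
    using assms by (intro prob_compl[symmetric] sets.finite_UN) auto
  also have "space M - (\<Union>q\<in>Q. {\<omega> \<in> space M. \<not> G q \<omega>}) = {\<omega> \<in> space M. \<forall>q\<in>Q. G q \<omega>}" by auto
  finally show ?thesis .
qed

theorem theorem3p0p9:
  shows "\<exists>C::real. C > 0 \<and>
    (\<forall>(D::nat) (N::nat) (P :: real vec set) (c::real) (\<epsilon>::real) (k::nat).
       D \<ge> 1 \<longrightarrow> N \<ge> 2 \<longrightarrow>
       P \<subseteq> carrier_vec D \<longrightarrow> finite P \<longrightarrow> card P = N \<longrightarrow>
       c > 0 \<longrightarrow>
       \<epsilon> \<in> {real N powr (- (c + 2) / 2) .. 1} \<longrightarrow>
       k = nat \<lceil>C * (ln (real N powr (c + 2)))\<^sup>2 / \<epsilon>\<^sup>2\<rceil> \<longrightarrow>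
       \<P>(A in cauchy_entries k D.
          \<forall>x\<in>P. \<forall>y\<in>P. norm1 (x - y) < 2 \<longrightarrow>
            (1 - \<epsilon>) * ((1 - \<epsilon>\<^sup>2 / sqrt 2) / (1 + 3 * \<epsilon>\<^sup>2)) * \<mu> (norm1 (x - y))
              \<le> \<rho> k (mat k D A *\<^sub>v x) (mat k D A *\<^sub>v y))
         \<ge> 1 - real N powr (- c))"
proof (intro exI[of _ "2 * 300000\<^sup>2"] conjI allI impI)
  fix D N :: nat and P :: "real vec set" and c \<epsilon> :: real and k :: nat
  assume N: "N \<ge> 2" and P: "P \<subseteq> carrier_vec D" "finite P" "card P = N" and c: "c > 0"
    and \<epsilon>: "\<epsilon> \<in> {real N powr (- (c + 2) / 2) .. 1}"
    and k: "k = nat \<lceil>2 * 300000\<^sup>2 * (ln (real N powr (c + 2)))\<^sup>2 / \<epsilon>\<^sup>2\<rceil>"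
  interpret prob_space "cauchy_entries k D" by (rule prob_space_cauchy_entries)
  define L where "L = ln (real N powr (c + 2))"
  define \<delta> where "\<delta> = (1 - \<epsilon>\<^sup>2 / sqrt 2) / (1 + 3 * \<epsilon>\<^sup>2)"
  have L_eq: "L = (c + 2) * ln (real N)" using N by (simp add: L_def ln_powr)
  \<comment> \<open>From \<open>c + 2 \<ge> 2\<close> and
    \<open>ln N \<ge> ln 2 \<ge> 1 / 2\<close>.\<close>
  have L: "1 \<le> L"
  proof -
    have "1 / 2 \<le> ln (2 :: real)" using ln_2_less_1 ln2_ge_two_thirds by linarith
    also have "\<dots> \<le> ln (real N)" using N by (intro ln_mono) auto
    finally have "2 * (1 / 2) \<le> (c + 2) * ln (real N)" using c by (intro mult_mono) auto
    then show ?thesis by (simp add: L_eq)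
  qed
  \<comment> \<open>The lower end of the range of \<open>\<epsilon>\<close> is exactly
    \<open>exp (- L / 2)\<close>.\<close>
  have \<epsilon>': "exp (- L / 2) \<le> \<epsilon>" "\<epsilon> \<le> 1"
    using \<epsilon> N by (auto simp: L_eq powr_def algebra_simps add_divide_distrib)
  have k': "2 * 300000\<^sup>2 * L\<^sup>2 / \<epsilon>\<^sup>2 \<le> real k"
    unfolding k L_def by (rule real_nat_ceiling_ge)
  have \<delta>: "\<delta> \<le> 1"
  proof -
    have "0 \<le> \<epsilon>\<^sup>2 / sqrt 2" "0 \<le> 3 * \<epsilon>\<^sup>2" by simp_all
    then have "1 - \<epsilon>\<^sup>2 / sqrt 2 \<le> 1 + 3 * \<epsilon>\<^sup>2" by linarith
    moreover have "1 + 3 * \<epsilon>\<^sup>2 > 0" by (intro add_pos_nonneg) auto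
    ultimately show ?thesis by (simp add: \<delta>_def)
  qed
  define G where "G = (\<lambda>(x, y) A. norm1 (x - y) < 2 \<longrightarrow>
    (1 - \<epsilon>) * \<delta> * \<mu> (norm1 (x - y)) \<le> \<rho> k (mat k D A *\<^sub>v x) (mat k D A *\<^sub>v y))"
  have bad: "{A \<in> space (cauchy_entries k D). \<not> G q A} \<in> events \<and>
      prob {A \<in> space (cauchy_entries k D). \<not> G q A} \<le> exp (- L)" if q: "q \<in> P \<times> P" for q
  proof -
    obtain x y where xy: "q = (x, y)" "x \<in> carrier_vec D" "y \<in> carrier_vec D"
      using q P by auto
    show ?thesis
    proof (cases "norm1 (x - y) < 2")
      case True
      then show ?thesis using prob_\<rho>_lower_tail[OF xy(2,3) True L \<epsilon>' k' \<delta>]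
        by (simp add: G_def xy(1) not_le)
    qed (simp add: G_def xy(1))
  qed
  have "1 - real (card (P \<times> P)) * exp (- L) \<le> prob {A \<in> space (cauchy_entries k D). \<forall>q\<in>P \<times> P. G q A}"
    using P bad by (intro prob_all_ge) auto
  \<comment> \<open>There are \<open>N\<^sup>2\<close> ordered pairs, diagonal included, each
    failing with probability at most \<open>exp (- L) = N powr (- (c + 2))\<close>; the 2 in the
    exponent absorbs the number of pairs.\<close>
  also have "real (card (P \<times> P)) * exp (- L) = real N powr (- c)"
  proof -
    have "exp (- L) = real N powr (- (c + 2))" using N by (simp add: L_eq powr_def algebra_simps)
    moreover have "real (card (P \<times> P)) = real N powr 2"
      using N P by (simp add: card_cartesian_product power2_eq_square)
    ultimately have "real (card (P \<times> P)) * exp (- L) = real N powr (2 + - (c + 2))"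
      by (simp only: powr_add)
    then show ?thesis by simp
  qed
  finally show "\<P>(A in cauchy_entries k D.
          \<forall>x\<in>P. \<forall>y\<in>P. norm1 (x - y) < 2 \<longrightarrow>
            (1 - \<epsilon>) * ((1 - \<epsilon>\<^sup>2 / sqrt 2) / (1 + 3 * \<epsilon>\<^sup>2)) * \<mu> (norm1 (x - y))
              \<le> \<rho> k (mat k D A *\<^sub>v x) (mat k D A *\<^sub>v y))
         \<ge> 1 - real N powr (- c)"
    by (simp add: G_def \<delta>_def)
qed simp

end
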